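(* The generating function $K_2(x)=\sum_{n\ge 0} k_n^{\#2}x^n$ of the sequence $\{k_n^{\#2}\}_{n\geq0}$ is $$K_2(x)= \frac{-1-\sqrt{1-8x}+\sqrt{1-8x}\,\sqrt{1-4x}+\sqrt{1-4x}+4x}{4}.$$
   Context: The m-implication of type 2 is the connective $\psi\leftharpoonup\phi\equiv\neg\psi\to\phi$, which has value 0 (false) exactly when $\psi$ and $\phi$ both have value 0, and value 1 (true) otherwise. A bracketed formula with $n$ distinct variables is obtained from $p_1\leftharpoonup p_2\leftharpoonup\cdots\leftharpoonup p_n$ (variables in this fixed order) by fully inserting brackets; for $n\ge2$ it has the form $\psi\leftharpoonup\phi$ with $\psi$ a bracketing of $p_1\leftharpoonup\cdots\leftharpoonup p_i$ and $\phi$ a bracketing of $p_{i+1}\leftharpoonup\cdots\leftharpoonup p_n$ for some $1\le i\le n-1$. A row is a pair consisting of a bracketed formula and a valuation of $p_1,\dots,p_n$ in $\{0,1\}$. For $n\ge 2$, $k_n^{\#2}$ is the number of rows (over all bracketed formulae in $n$ variables) for which $\psi$ has value 1 and $\phi$ has value 0 (so that $\psi\leftharpoonup\phi$ is true); $k_0^{\#2}=k_1^{\#2}=0$. Square roots denote formal power series with positive constant term. *)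

theory Defs
  imports
    "HOL-Library.FuncSet"
    "HOL-Computational_Algebra.Formal_Power_Series"
begin

datatype form = Var nat | MImp2 form form  (infixr \<open>\<leftharpoonup>\<close> 60)

primrec val :: "(nat \<Rightarrow> bool) \<Rightarrow> form \<Rightarrow> bool" where
  "val v (Var i) = v i"
| "val v (\<psi> \<leftharpoonup> \<phi>) = (\<not> val v \<psi> \<longrightarrow> val v \<phi>)"

text \<open>\<open>bracketing i j F\<close>: the formula \<open>F\<close> arises by fully bracketing
  \<open>p\<^sub>i \<leftharpoonup> p\<^sub>i\<^sub>+\<^sub>1 \<leftharpoonup> \<dots> \<leftharpoonup> p\<^sub>j\<close>, where \<open>p\<^sub>k\<close> is \<open>Var k\<close>.\<close>

inductive bracketing :: "nat \<Rightarrow> nat \<Rightarrow> form \<Rightarrow> bool" where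
  single: "bracketing i i (Var i)"
| split: "bracketing i m \<psi> \<Longrightarrow> bracketing (Suc m) j \<phi> \<Longrightarrow> bracketing i j (\<psi> \<leftharpoonup> \<phi>)"

text \<open>Valuations of \<open>p\<^sub>1, \<dots>, p\<^sub>n\<close> are extensional functions on \<open>{1..n}\<close>, so that there
  are exactly \<open>2 ^ n\<close> of them.\<close>

definition rows :: "nat \<Rightarrow> (form \<times> (nat \<Rightarrow> bool)) set" where
  "rows n = {F. bracketing 1 n F} \<times> ({1..n} \<rightarrow>\<^sub>E UNIV)"

definition k2 :: "nat \<Rightarrow> nat" where
  "k2 n = (if n < 2 then 0
     else card {(F, v) \<in> rows n. \<exists>\<psi> \<phi>. F = \<psi> \<leftharpoonup> \<phi> \<and> val v \<psi> \<and> \<not> val v \<phi>})"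

definition K2 :: "real fps" where
  "K2 = Abs_fps (\<lambda>n. of_nat (k2 n))"

definition fps_sqrt :: "real fps \<Rightarrow> real fps" where
  "fps_sqrt f = fps_radical root 2 f"

lemma bracketing_le: "bracketing i j F \<Longrightarrow> i \<le> j"
  by (induction rule: bracketing.induct) auto

lemma finite_bracketing: "finite {F. bracketing i j F}"
proof (induction "Suc j - i" arbitrary: i j rule: less_induct)
  case less
  have "{F. bracketing i j F} \<subseteq> {Var i} \<union>
    (\<Union>m\<in>{i..<j}. (\<lambda>(\<psi>, \<phi>). \<psi> \<leftharpoonup> \<phi>) ` ({F. bracketing i m F} \<times> {F. bracketing (Suc m) j F}))"
    (is "_ \<subseteq> ?R")
  proof
    fix F assume "F \<in> {F. bracketing i j F}"
    then have "bracketing i j F" by simp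
    then show "F \<in> ?R"
    proof cases
      case (split m \<psi> \<phi>)
      moreover have "i \<le> m" "Suc m \<le> j"
        using split bracketing_le by blast+
      ultimately show ?thesis by force
    qed simp
  qed
  moreover have "finite ?R"
    by (intro finite_UnI finite_UN_I finite_imageI finite_cartesian_product less) auto
  ultimately show ?case by (rule finite_subset)
qed

lemma finite_rows: "finite (rows n)"
  unfolding rows_def
  by (intro finite_cartesian_product finite_bracketing finite_PiE) auto

lemma fps_sqrt_unique:
  assumes "fps_nth f 0 > 0"
  shows "g = fps_sqrt f \<longleftrightarrow> g ^ 2 = f \<and> fps_nth g 0 > 0"
proof
  have r: "root (Suc 1) (fps_nth f 0) ^ Suc 1 = fps_nth f 0"
    using assms by (simp add: real_root_pow_pos2 numeral_2_eq_2[symmetric] del: power_Suc)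
  {
    assume "g = fps_sqrt f"
    then show "g ^ 2 = f \<and> fps_nth g 0 > 0"
      using assms r power_radical[of f root 1]
      by (auto simp: fps_sqrt_def numeral_2_eq_2 simp del: power_Suc)
  next
    assume g: "g ^ 2 = f \<and> fps_nth g 0 > 0"
    then have "fps_nth f 0 = fps_nth g 0 ^ 2"
      by (auto simp: fps_nth_power_0)
    then have "root (Suc 1) (fps_nth f 0) = fps_nth g 0"
      using g by (metis One_nat_def Suc_1 less_imp_le real_root_power_cancel zero_less_numeral)
    from radical_unique[where r = root and k = 1, OF r this] assms g show "g = fps_sqrt f"
      by (auto simp: fps_sqrt_def numeral_2_eq_2 simp del: power_Suc)
  }
qed

end

theory Submission
  imports Defs
begin

text \<open>A bracketed formula is false exactly under the all-zero valuation of its variables. Hence a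
  pair of bracketings on \<open>m\<close> and \<open>n - m\<close> variables contributes \<open>2 ^ m - 1\<close> rows, and
  \<open>K\<^sub>2 = (W - C) C\<close>, where \<open>C\<close> counts bracketings and \<open>W(x) = C(2x)\<close> counts rows. The equation
  \<open>C = x + C\<^sup>2\<close> gives \<open>1 - 2 C = \<surd>(1 - 4 x)\<close> and \<open>1 - 2 W = \<surd>(1 - 8 x)\<close>.\<close>

section \<open>Truth values and the number of bracketings\<close>

lemma val_bracketing: "bracketing i j F \<Longrightarrow> val v F \<longleftrightarrow> (\<exists>k\<in>{i..j}. v k)"
proof (induction rule: bracketing.induct)
  case (split i m \<psi> j \<phi>)
  then have "i \<le> m" "Suc m \<le> j"
    using bracketing_le by blast+
  then have "{i..j} = {i..m} \<union> {Suc m..j}"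
    by auto
  then show ?case
    using split by auto
qed simp

text \<open>The right endpoint of a bracketing can be read off the formula, so the left factor of a
  compound formula determines the split position. This makes the unions over split positions below
  disjoint.\<close>

primrec last_var :: "form \<Rightarrow> nat" where
  "last_var (Var i) = i"
| "last_var (\<psi> \<leftharpoonup> \<phi>) = last_var \<phi>"

lemma last_var_bracketing: "bracketing i j F \<Longrightarrow> last_var F = j"
  by (induction rule: bracketing.induct) auto

lemma bracketing_Var_iff: "bracketing i j (Var k) \<longleftrightarrow> i = k \<and> j = k"
  using bracketing.cases[of i j "Var k"] bracketing.single by auto

lemma bracketing_MImp2_iff:
  "bracketing i j (\<psi> \<leftharpoonup> \<phi>) \<longleftrightarrow> (\<exists>m\<in>{i..<j}. bracketing i m \<psi> \<and> bracketing (Suc m) j \<phi>)"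
proof
  assume "bracketing i j (\<psi> \<leftharpoonup> \<phi>)"
  then show "\<exists>m\<in>{i..<j}. bracketing i m \<psi> \<and> bracketing (Suc m) j \<phi>"
  proof cases
    case (split m)
    moreover from this have "i \<le> m" "Suc m \<le> j"
      using bracketing_le by blast+
    ultimately show ?thesis by auto
  qed
qed (auto intro: bracketing.intros)

text \<open>For \<open>i < j\<close> a variable cannot occur as the whole formula, and a compound
  one corresponds to exactly one split position and one pair of factors, since the constructor is
  injective.\<close>

lemma card_bracketing_rec:
  assumes "i < j"
  shows "card {F. bracketing i j F} =
    (\<Sum>m\<in>{i..<j}. card {F. bracketing i m F} * card {F. bracketing (Suc m) j F})"
proof -
  let ?S = "\<lambda>m. {F. bracketing i m F} \<times> {F. bracketing (Suc m) j F}"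
  have eq: "{F. bracketing i j F} = (\<lambda>(\<psi>, \<phi>). \<psi> \<leftharpoonup> \<phi>) ` (\<Union>m\<in>{i..<j}. ?S m)"
  proof (intro set_eqI)
    fix F
    show "F \<in> {F. bracketing i j F} \<longleftrightarrow> F \<in> (\<lambda>(\<psi>, \<phi>). \<psi> \<leftharpoonup> \<phi>) ` (\<Union>m\<in>{i..<j}. ?S m)"
      using assms by (cases F) (auto simp: bracketing_Var_iff bracketing_MImp2_iff image_iff)
  qed
  have "card {F. bracketing i j F} = card (\<Union>m\<in>{i..<j}. ?S m)"
    unfolding eq by (rule card_image) (auto simp: inj_on_def)
  also have "\<dots> = (\<Sum>m\<in>{i..<j}. card (?S m))"
    by (rule card_UN_disjoint) (auto simp: finite_bracketing dest: last_var_bracketing)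
  finally show ?thesis
    by (simp add: card_cartesian_product)
qed

lemma bracketing_diag: "{F. bracketing i i F} = {Var i}"
proof (intro set_eqI)
  fix F
  show "F \<in> {F. bracketing i i F} \<longleftrightarrow> F \<in> {Var i}"
    by (cases F) (auto simp: bracketing_Var_iff bracketing_MImp2_iff)
qed

text \<open>Both counts obey the same recurrence, so induction on the length of the interval
  replaces an explicit renaming of variables.\<close>

lemma card_bracketing_Suc:
  "card {F. bracketing (Suc i) (Suc j) F} = card {F. bracketing i j F}"
proof (induction "j - i" arbitrary: i j rule: less_induct)
  case less
  consider "j < i" | "i = j" | "i < j" by linarith
  then show ?case
  proof cases
    case 1
    then have "{F. bracketing i j F} = {}" "{F. bracketing (Suc i) (Suc j) F} = {}"
      by (auto dest: bracketing_le)
    then show ?thesis by (simp only:)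
  next
    case 2
    then show ?thesis by (simp add: bracketing_diag)
  next
    case 3
    have "card {F. bracketing (Suc i) (Suc j) F} = (\<Sum>m\<in>{i..<j}.
        card {F. bracketing (Suc i) (Suc m) F} * card {F. bracketing (Suc (Suc m)) (Suc j) F})"
      using 3 by (simp only: card_bracketing_rec[of "Suc i" "Suc j"] Suc_less_eq
          sum.shift_bounds_Suc_ivl)
    also have "\<dots> = (\<Sum>m\<in>{i..<j}. card {F. bracketing i m F} * card {F. bracketing (Suc m) j F})"
      by (intro sum.cong refl arg_cong2[where f = "(*)"] less) auto
    finally show ?thesis
      by (simp only: card_bracketing_rec[OF 3])
  qed
qed

lemma card_bracketing_shift:
  "card {F. bracketing (i + k) (j + k) F} = card {F. bracketing i j F}"
  by (induction k) (simp_all add: card_bracketing_Suc)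

text \<open>For n \<ge> 1 this is the Catalan number of index n - 1.\<close>

definition brackets :: "nat \<Rightarrow> nat" where
  "brackets n = card {F. bracketing 1 n F}"

lemma card_bracketing_eq_brackets:
  "m \<le> n \<Longrightarrow> card {F. bracketing (Suc m) n F} = brackets (n - m)"
  using card_bracketing_shift[of 1 m "n - m"] by (simp add: brackets_def)

lemma brackets_0 [simp]: "brackets 0 = 0"
proof -
  have "{F. bracketing 1 0 F} = {}"
    by (auto dest: bracketing_le)
  then show ?thesis
    by (simp only: brackets_def card.empty)
qed

lemma brackets_1 [simp]: "brackets (Suc 0) = 1"
  by (simp add: brackets_def bracketing_diag)

lemma brackets_rec:
  assumes "n \<ge> 2"
  shows "brackets n = (\<Sum>m\<in>{1..<n}. brackets m * brackets (n - m))"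
proof -
  have "brackets n = (\<Sum>m\<in>{1..<n}. brackets m * card {F. bracketing (Suc m) n F})"
    using card_bracketing_rec[of 1 n] assms by (simp add: brackets_def)
  then show ?thesis
    by (simp add: card_bracketing_eq_brackets)
qed

section \<open>Counting valuations and rows\<close>

lemma card_valuations:
  fixes m n :: nat
  assumes "m \<le> n"
  shows "card {v \<in> {1..n} \<rightarrow>\<^sub>E UNIV. (\<exists>k\<in>{1..m}. v k) \<and> \<not> (\<exists>k\<in>{Suc m..n}. v k)} = 2 ^ m - 1"
proof -
  \<comment> \<open>\<open>?P\<close> consists of the valuations that are false beyond position
    \<open>m\<close>; the first \<open>m\<close> values are free. Truth of some variable among the
    first \<open>m\<close> excludes only the all-false valuation \<open>?z\<close>.\<close>
  let ?P = "PiE {1..n} (\<lambda>k. if k \<le> m then UNIV else {False})"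
  let ?z = "\<lambda>k\<in>{1..n}. False"
  have z: "?z \<in> ?P" by auto
  have "{v \<in> {1..n} \<rightarrow>\<^sub>E UNIV. (\<exists>k\<in>{1..m}. v k) \<and> \<not> (\<exists>k\<in>{Suc m..n}. v k)} = ?P - {?z}"
  proof (intro set_eqI iffI)
    fix v
    assume v: "v \<in> {v \<in> {1..n} \<rightarrow>\<^sub>E UNIV. (\<exists>k\<in>{1..m}. v k) \<and> \<not> (\<exists>k\<in>{Suc m..n}. v k)}"
    then obtain k where "k \<in> {1..m}" "v k" by auto
    then have "v \<noteq> ?z" using assms by auto
    moreover have "v \<in> ?P" using v by (auto simp: PiE_iff)
    ultimately show "v \<in> ?P - {?z}" by simp
  next
    fix v
    assume v: "v \<in> ?P - {?z}"
    have "\<exists>k\<in>{1..n}. v k"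
    proof (rule ccontr)
      assume "\<not> (\<exists>k\<in>{1..n}. v k)"
      then have "v = ?z" using v by (intro ext) (auto simp: PiE_iff extensional_def)
      with v show False by simp
    qed
    moreover have f: "\<not> v k" if "k \<in> {Suc m..n}" for k
    proof -
      have "v k \<in> (if k \<le> m then UNIV else {False})"
        using v that by (intro PiE_mem[of v "{1..n}"]) auto
      with that show ?thesis by simp
    qed
    ultimately have "\<exists>k\<in>{1..m}. v k"
      by (metis atLeastAtMost_iff not_less_eq_eq)
    then show "v \<in> {v \<in> {1..n} \<rightarrow>\<^sub>E UNIV. (\<exists>k\<in>{1..m}. v k) \<and> \<not> (\<exists>k\<in>{Suc m..n}. v k)}"
      using v f by (auto simp: PiE_iff)
  qed
  moreover have "card ?P = 2 ^ m"
  proof -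
    have "card ?P = (\<Prod>k\<in>{1..n}. if k \<le> m then 2 else 1)"
      by (subst card_PiE) (auto intro!: prod.cong)
    also have "\<dots> = (\<Prod>k\<in>{1..m}. 2)"
      using assms by (intro prod.mono_neutral_cong_right) auto
    finally show ?thesis by simp
  qed
  ultimately show ?thesis
    using z by simp
qed

text \<open>Once the split position is fixed, \<open>val_bracketing\<close> turns the truth
  condition into one on the valuation alone, whatever the two factors are. So left factors, right
  factors and valuations are counted independently. For \<open>n < 2\<close> the sum is
  empty.\<close>

lemma k2_eq: "k2 n = (\<Sum>m\<in>{1..<n}. (2 ^ m - 1) * brackets m * brackets (n - m))"
proof (cases "n < 2")
  case False
  let ?V = "\<lambda>m. {v \<in> {1..n} \<rightarrow>\<^sub>E UNIV. (\<exists>k\<in>{1..m}. v k) \<and> \<not> (\<exists>k\<in>{Suc m..n}. v k)}"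
  let ?S = "\<lambda>m. ({F. bracketing 1 m F} \<times> {F. bracketing (Suc m) n F}) \<times> ?V m"
  let ?R = "{(F, v) \<in> rows n. \<exists>\<psi> \<phi>. F = \<psi> \<leftharpoonup> \<phi> \<and> val v \<psi> \<and> \<not> val v \<phi>}"
  have finV: "finite (?V m)" for m
    by (rule finite_subset[OF _ finite_PiE[of "{1..n}" "\<lambda>_. UNIV :: bool set"]]) auto
  have eq: "?R = (\<lambda>((\<psi>, \<phi>), v). (\<psi> \<leftharpoonup> \<phi>, v)) ` (\<Union>m\<in>{1..<n}. ?S m)"
  proof (intro set_eqI iffI)
    fix r assume "r \<in> ?R"
    then obtain \<psi> \<phi> v where r: "r = (\<psi> \<leftharpoonup> \<phi>, v)" "bracketing 1 n (\<psi> \<leftharpoonup> \<phi>)"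
      "v \<in> {1..n} \<rightarrow>\<^sub>E UNIV" "val v \<psi>" "\<not> val v \<phi>"
      by (auto simp: rows_def)
    then obtain m where m: "m \<in> {1..<n}" "bracketing 1 m \<psi>" "bracketing (Suc m) n \<phi>"
      by (auto simp: bracketing_MImp2_iff)
    have "((\<psi>, \<phi>), v) \<in> ?S m"
      using r m val_bracketing[OF m(2), of v] val_bracketing[OF m(3), of v] by simp
    then show "r \<in> (\<lambda>((\<psi>, \<phi>), v). (\<psi> \<leftharpoonup> \<phi>, v)) ` (\<Union>m\<in>{1..<n}. ?S m)"
      using m(1) r(1) by (intro image_eqI[where x = "((\<psi>, \<phi>), v)"]) (simp, blast)
  next
    fix r assume "r \<in> (\<lambda>((\<psi>, \<phi>), v). (\<psi> \<leftharpoonup> \<phi>, v)) ` (\<Union>m\<in>{1..<n}. ?S m)"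
    then obtain s where s: "s \<in> (\<Union>m\<in>{1..<n}. ?S m)" "r = (\<lambda>((\<psi>, \<phi>), v). (\<psi> \<leftharpoonup> \<phi>, v)) s"
      by (rule imageE)
    obtain \<psi> \<phi> v where "s = ((\<psi>, \<phi>), v)"
      by (metis prod.exhaust)
    with s obtain m where r: "r = (\<psi> \<leftharpoonup> \<phi>, v)"
      and \<psi>: "bracketing 1 m \<psi>" and \<phi>: "bracketing (Suc m) n \<phi>" and v: "v \<in> ?V m"
      by auto
    have "bracketing 1 n (\<psi> \<leftharpoonup> \<phi>)"
      using \<psi> \<phi> by (rule bracketing.split)
    then show "r \<in> ?R"
      using v r val_bracketing[OF \<psi>, of v] val_bracketing[OF \<phi>, of v] by (simp add: rows_def)
  qed
  have "card ?R = card (\<Union>m\<in>{1..<n}. ?S m)"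
    unfolding eq by (rule card_image) (auto simp: inj_on_def)
  also have "\<dots> = (\<Sum>m\<in>{1..<n}. card (?S m))"
    \<comment> \<open>The index \<open>m\<close> is recovered as \<open>last_var\<close> of the left
      factor, hence the sets are disjoint.\<close>
    using finV
    by (intro card_UN_disjoint) (auto simp: finite_bracketing dest: last_var_bracketing)
  also have "\<dots> = (\<Sum>m\<in>{1..<n}. (2 ^ m - 1) * brackets m * brackets (n - m))"
  proof (rule sum.cong[OF refl])
    fix m assume "m \<in> {1..<n}"
    then have "m \<le> n" by simp
    show "card (?S m) = (2 ^ m - 1) * brackets m * brackets (n - m)"
      unfolding card_cartesian_product card_valuations[OF \<open>m \<le> n\<close>]
        card_bracketing_eq_brackets[OF \<open>m \<le> n\<close>] brackets_def[symmetric] by simp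
  qed
  finally show ?thesis
    using False by (simp add: k2_def)
qed (auto simp: k2_def)

section \<open>Generating functions and square roots\<close>

definition brackets_fps :: "real \<Rightarrow> real fps" where
  "brackets_fps a = Abs_fps (\<lambda>n. a ^ n * brackets n)"

text \<open>Vanishing constant terms kill the two end terms of the Cauchy product, which leaves the
  range of the counting sums above.\<close>

lemma fps_mult_nth_interior:
  fixes f g :: "'a::semiring_0 fps"
  assumes "fps_nth f 0 = 0" and "fps_nth g 0 = 0"
  shows "fps_nth (f * g) n = (\<Sum>m\<in>{1..<n}. fps_nth f m * fps_nth g (n - m))"
  unfolding fps_mult_nth
  using assms by (intro sum.mono_neutral_right) (auto simp: not_less_eq_eq not_less)

text \<open>This is the Catalan equation after substituting \<open>a\<close> x for x: the weight
  \<open>a ^ n\<close> splits as \<open>a ^ m * a ^ (n - m)\<close>, so the recurrence survives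
  scaling. Its instances 1 and 2 are C and W.\<close>

lemma brackets_fps_eq: "brackets_fps a = fps_const a * fps_X + brackets_fps a ^ 2"
proof (rule fps_ext)
  fix n
  have sq: "fps_nth (brackets_fps a ^ 2) n =
      a ^ n * real (\<Sum>m\<in>{1..<n}. brackets m * brackets (n - m))"
  proof -
    have "fps_nth (brackets_fps a ^ 2) n =
        (\<Sum>m\<in>{1..<n}. (a ^ m * brackets m) * (a ^ (n - m) * brackets (n - m)))"
      unfolding power2_eq_square by (subst fps_mult_nth_interior) (simp_all add: brackets_fps_def)
    also have "\<dots> = (\<Sum>m\<in>{1..<n}. a ^ n * real (brackets m * brackets (n - m)))"
    proof (rule sum.cong[OF refl])
      fix m assume "m \<in> {1..<n}"
      then have "a ^ n = a ^ m * a ^ (n - m)"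
        by (simp flip: power_add)
      then show "(a ^ m * brackets m) * (a ^ (n - m) * brackets (n - m)) =
          a ^ n * real (brackets m * brackets (n - m))"
        by simp
    qed
    finally show ?thesis
      by (simp add: sum_distrib_left)
  qed
  consider "n = 0" | "n = 1" | "n \<ge> 2" by linarith
  then show "fps_nth (brackets_fps a) n =
      fps_nth (fps_const a * fps_X + brackets_fps a ^ 2) n"
  proof cases
    \<comment> \<open>The recurrence starts at 2; the linear term accounts for the coefficient at
      1.\<close>
    case 3
    then show ?thesis
      using sq brackets_rec[OF 3] by (simp add: brackets_fps_def)
  qed (use sq in \<open>simp_all add: brackets_fps_def\<close>)
qed

text \<open>Completing the square in the quadratic equation gives a square root, and its constant
  term 1 selects the positive branch.\<close>

lemma fps_sqrt_brackets: "fps_sqrt (1 - 4 * fps_const a * fps_X) = 1 - 2 * brackets_fps a"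
proof -
  have "(1 - 2 * brackets_fps a) ^ 2 = 1 - 4 * fps_const a * fps_X"
    using brackets_fps_eq[of a] by algebra
  then show ?thesis
    using fps_sqrt_unique[of "1 - 4 * fps_const a * fps_X" "1 - 2 * brackets_fps a"]
    by (simp add: brackets_fps_def)
qed

lemma K2_eq: "K2 = (brackets_fps 2 - brackets_fps 1) * brackets_fps 1"
proof (rule fps_ext)
  fix n
  have "fps_nth ((brackets_fps 2 - brackets_fps 1) * brackets_fps 1) n =
      (\<Sum>m\<in>{1..<n}. (2 ^ m * real (brackets m) - real (brackets m)) * real (brackets (n - m)))"
    by (subst fps_mult_nth_interior) (simp_all add: brackets_fps_def)
  also have "\<dots> = (\<Sum>m\<in>{1..<n}. real ((2 ^ m - 1) * brackets m * brackets (n - m)))"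
    \<comment> \<open>The truncated subtraction in \<nat> agrees with the real one because 2 ^ m
      \<ge> 1.\<close>
    by (intro sum.cong) (simp_all add: of_nat_diff algebra_simps)
  finally show "fps_nth K2 n = fps_nth ((brackets_fps 2 - brackets_fps 1) * brackets_fps 1) n"
    by (simp add: K2_def k2_eq)
qed

theorem proposition6p15:
  shows "K2 = (- 1 - fps_sqrt (1 - 8 * fps_X) + fps_sqrt (1 - 8 * fps_X) * fps_sqrt (1 - 4 * fps_X)
                + fps_sqrt (1 - 4 * fps_X) + 4 * fps_X) / 4"
proof -
  let ?C = "brackets_fps 1" and ?W = "brackets_fps 2"
  have "fps_sqrt (1 - 4 * fps_X) = 1 - 2 * ?C"
    using fps_sqrt_brackets[of 1] by simp
  moreover have "fps_sqrt (1 - 8 * fps_X) = 1 - 2 * ?W"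
    using fps_sqrt_brackets[of 2] by (simp flip: numeral_fps_const)
  moreover have "?C = fps_X + ?C ^ 2"
    using brackets_fps_eq[of 1] by simp
  \<comment> \<open>The left side expands to 4 W C - 4 (C - x), and C - x is the square of
    C.\<close>
  then have "- 1 - (1 - 2 * ?W) + (1 - 2 * ?W) * (1 - 2 * ?C) + (1 - 2 * ?C) + 4 * fps_X
      = 4 * ((?W - ?C) * ?C)"
    by algebra
  ultimately show ?thesis
    by (simp add: K2_eq)
qed

end
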